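(* Let $\mathbb{H}$ be a real Hilbert space and let $\mathbb{P}=\mathbb{H}\oplus\mathbb{H}$ be the canonical Hilbert phase space with its canonical symplectic form. Let $V:\mathbb{H}\to\mathbb{R}$ be $C^2$ (in the Fréchet sense) and assume that the Hessian operator $D(\nabla V)(q):\mathbb{H}\to\mathbb{H}$ is self-adjoint for every $q$. Define the nonlinear shear $$\Phi_V(q,p):=\big(q,\;p+\nabla V(q)\big).$$ Then $\Phi_V$ is a symplectomorphism on its domain. Similarly, if $W:\mathbb{H}\to\mathbb{R}$ is $C^2$ with $D(\nabla W)(p)$ self-adjoint for every $p$, then $$\Psi_W(q,p):=\big(q+\nabla W(p),\;p\big)$$ is symplectic.
   Context: The phase space $\mathbb{P}=\mathbb{H}\oplus\mathbb{H}$ carries the inner product $\langle(q,p),(q',p')\rangle_{\mathbb{P}}=\langle q,q'\rangle_{\mathbb{H}}+\langle p,p'\rangle_{\mathbb{H}}$, the operator $J(q,p)=(-p,q)$ and the symplectic form $\omega(u,v)=\langle Ju,v\rangle_{\mathbb{P}}$. The gradient $\nabla V(q)\in\mathbb{H}$ is the Riesz representative of the Fréchet derivative: $DV(q)[h]=\langle\nabla V(q),h\rangle$ for all $h\in\mathbb{H}$; $D(\nabla V)(q)$ is the Fréchet derivative of the gradient map, a bounded linear operator on $\mathbb{H}$. A map $\Phi:\mathbb{P}\to\mathbb{P}$ is symplectic (a symplectomorphism) if it is a $C^1$ diffeomorphism and $\Phi^*\omega=\omega$, i.e. $\omega(D\Phi(u)v,D\Phi(u)w)=\omega(v,w)$ for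 all $u,v,w\in\mathbb{P}$; equivalently $(D\Phi(u))^*J\,D\Phi(u)=J$ for all $u$. *)

theory Defs
  imports "HOL-Analysis.Analysis"
begin

text \<open>
  Real Hilbert spaces are types of sort \<open>{real_inner, complete_space}\<close>.  The phase space over
  \<open>'a\<close> is \<open>'a \<times> 'a\<close>, whose library inner product is the sum of the componentwise ones.
\<close>

definition phase_J :: "'a::real_inner \<times> 'a \<Rightarrow> 'a \<times> 'a" where
  "phase_J = (\<lambda>(q, p). (- p, q))"

definition symplectic_form :: "'a::real_inner \<times> 'a \<Rightarrow> 'a \<times> 'a \<Rightarrow> real" where
  "symplectic_form u v = phase_J u \<bullet> v"

text \<open>
  Continuity of the derivatives below is with respect to the operator norm, i.e. the norm of the
  type of bounded linear functions.
\<close>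

definition C1_map :: "('a::real_normed_vector \<Rightarrow> 'b::real_normed_vector) \<Rightarrow> bool" where
  "C1_map f \<longleftrightarrow>
    (\<exists>f' :: 'a \<Rightarrow> 'a \<Rightarrow>\<^sub>L 'b.
      (\<forall>x. (f has_derivative blinfun_apply (f' x)) (at x)) \<and> continuous_on UNIV f')"

definition C2_map :: "('a::real_normed_vector \<Rightarrow> 'b::real_normed_vector) \<Rightarrow> bool" where
  "C2_map f \<longleftrightarrow>
    (\<exists>f' :: 'a \<Rightarrow> 'a \<Rightarrow>\<^sub>L 'b.
      (\<forall>x. (f has_derivative blinfun_apply (f' x)) (at x)) \<and> C1_map f')"

text \<open>
  On a Hilbert space the description is proper wherever \<open>V\<close> is Frechet differentiable, by the
  Riesz representation theorem.
\<close>

definition gradient :: "('a::{real_inner, complete_space} \<Rightarrow> real) \<Rightarrow> 'a \<Rightarrow> 'a" where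
  "gradient V q = (THE g. GDERIV V q :> g)"

text \<open>
  The library's \<open>adjoint\<close> is a choice from all adjoints of an operator; for a bounded operator on
  a Hilbert space there is exactly one.
\<close>

definition self_adjoint :: "('a::{real_inner, complete_space} \<Rightarrow> 'a) \<Rightarrow> bool" where
  "self_adjoint A \<longleftrightarrow> bounded_linear A \<and> adjoint A = A"

definition C1_diffeomorphism :: "('a::real_normed_vector \<Rightarrow> 'b::real_normed_vector) \<Rightarrow> bool" where
  "C1_diffeomorphism \<Phi> \<longleftrightarrow> bij \<Phi> \<and> C1_map \<Phi> \<and> C1_map (inv \<Phi>)"

definition symplectomorphism ::
    "('a::{real_inner, complete_space} \<times> 'a \<Rightarrow> 'a \<times> 'a) \<Rightarrow> bool" where
  "symplectomorphism \<Phi> \<longleftrightarrow>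
    C1_diffeomorphism \<Phi> \<and>
    (\<forall>u v w. symplectic_form (frechet_derivative \<Phi> (at u) v) (frechet_derivative \<Phi> (at u) w)
      = symplectic_form v w)"

definition momentum_shear ::
    "('a::{real_inner, complete_space} \<Rightarrow> real) \<Rightarrow> 'a \<times> 'a \<Rightarrow> 'a \<times> 'a" where
  "momentum_shear V = (\<lambda>(q, p). (q, p + gradient V q))"

definition position_shear ::
    "('a::{real_inner, complete_space} \<Rightarrow> real) \<Rightarrow> 'a \<times> 'a \<Rightarrow> 'a \<times> 'a" where
  "position_shear W = (\<lambda>(q, p). (q + gradient W p, p))"

end

theory Submission
  imports Defs
begin

text \<open>
  Write \<open>H(q)\<close> for the derivative of \<open>\<nabla>V\<close> at \<open>q\<close>.  The shear \<open>(q, p) \<mapsto> (q, p + \<nabla>V q)\<close> moves each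
  point only in the momentum direction, by an amount that depends only on the unchanged position.
  Subtracting that amount again inverts it, so the inverse is the shear by \<open>- \<nabla>V\<close>, and both maps
  are \<open>C\<^sup>1\<close> as soon as \<open>\<nabla>V\<close> is (\<open>C1_diffeomorphism_shear\<close>).  The derivative sends \<open>(a, b)\<close> to
  \<open>(a, b + H(q) a)\<close>, which changes \<open>\<omega>((a, b), (c, d)) = \<langle>a, d\<rangle> - \<langle>b, c\<rangle>\<close> by
  \<open>\<langle>a, H(q) c\<rangle> - \<langle>H(q) a, c\<rangle>\<close>; this is zero because \<open>H(q)\<close> is self-adjoint.  The position shear is
  the same with the roles of the two components exchanged.

  The functional analysis behind this is the Riesz representation theorem
  (\<open>riesz_representation\<close>), which enters twice.  It makes \<open>\<nabla>V\<close> the composition of the derivative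
  of \<open>V\<close> with a bounded linear isomorphism from the dual space to the space itself, so that \<open>\<nabla>V\<close>
  inherits \<open>C\<^sup>1\<close> from the derivative (\<open>C1_map_gradient\<close>).  It also provides an adjoint for every
  bounded operator, without which an equation \<open>adjoint A = A\<close>, where \<open>adjoint\<close> is a choice operator,
  would not yield \<open>\<langle>A x, y\<rangle> = \<langle>x, A y\<rangle>\<close> (\<open>self_adjoint_inner\<close>).
\<close>

section \<open>Riesz representation and adjoints\<close>

text \<open>
  A point where the functional \<open>x \<mapsto> \<parallel>x\<parallel>\<^sup>2 - 2 f x\<close> attains its minimum represents \<open>f\<close>, because a
  nonzero first variation \<open>d = \<langle>g, h\<rangle> - f h\<close> in a direction \<open>h\<close> would allow a further decrease.
\<close>

lemma quadratic_minimizer_represents: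
  fixes f :: "'a::real_inner \<Rightarrow> real"
  assumes f: "linear f"
    and min: "\<And>x. (norm g)\<^sup>2 - 2 * f g \<le> (norm x)\<^sup>2 - 2 * f x"
  shows "f h = g \<bullet> h"
proof (rule ccontr)
  define d where "d = g \<bullet> h - f h"
  define c where "c = (norm h)\<^sup>2"
  assume "f h \<noteq> g \<bullet> h"
  then have "d \<noteq> 0" by (simp add: d_def)
  have "c \<ge> 0" by (simp add: c_def)
  \<comment> \<open>The minimum over \<open>t\<close> of \<open>t\<^sup>2 c + 2 t d\<close> lies at \<open>- d / c\<close>; the extra \<open>1\<close> admits \<open>c = 0\<close>.\<close>
  define t where "t = - d / (c + 1)"
  have d: "d = - (t * (c + 1))"
    using \<open>c \<ge> 0\<close> by (simp add: t_def)
  have "(norm (g + t *\<^sub>R h))\<^sup>2 = (norm g)\<^sup>2 + 2 * t * (g \<bullet> h) + t\<^sup>2 * c"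
    unfolding c_def power2_norm_eq_inner
    by (simp add: inner_add_left inner_add_right inner_commute[of h g] power2_eq_square
        del: dot_square_norm) algebra
  then have "(norm (g + t *\<^sub>R h))\<^sup>2 - 2 * f (g + t *\<^sub>R h)
      = (norm g)\<^sup>2 - 2 * f g + (t\<^sup>2 * c + 2 * t * d)"
    using f by (simp add: linear_add linear_scale d_def algebra_simps)
  with min[of "g + t *\<^sub>R h"] have "0 \<le> t\<^sup>2 * c + 2 * t * d" by simp
  also have "t\<^sup>2 * c + 2 * t * d = - (t\<^sup>2 * (c + 2))"
    by (simp add: d power2_eq_square algebra_simps)
  also have "\<dots> < 0"
    using \<open>c \<ge> 0\<close> \<open>d \<noteq> 0\<close> d by (auto intro!: mult_pos_pos)
  finally show False by simp
qed

text \<open>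
  The parallelogram law turns near-minimality of the values of \<open>x \<mapsto> \<parallel>x\<parallel>\<^sup>2 - 2 f x\<close> into closeness of
  the points, so a minimizing sequence is Cauchy and completeness provides a minimizer.
\<close>

lemma riesz_representation:
  fixes f :: "'a::{real_inner, complete_space} \<Rightarrow> real"
  assumes "bounded_linear f"
  shows "\<exists>g. \<forall>h. f h = g \<bullet> h"
proof -
  interpret f: bounded_linear f by fact
  define Q where "Q x = (norm x)\<^sup>2 - 2 * f x" for x
  obtain K where K: "\<And>x. norm (f x) \<le> norm x * K"
    using f.bounded by blast
  have lower: "- K\<^sup>2 \<le> Q x" for x
  proof -
    have "f x \<le> norm x * K" using K[of x] by simp
    then show ?thesis
      using zero_le_power2[of "norm x - K"] by (simp add: Q_def power2_diff)
  qed
  define I where "I = Inf (range Q)"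
  have bdd: "bdd_below (range Q)"
    using lower by (auto intro!: bdd_belowI)
  have I_le: "I \<le> Q x" for x
    unfolding I_def using bdd by (simp add: cINF_lower)
  have "\<exists>x. Q x < I + inverse (real (Suc n))" for n
    using cInf_lessD[of "range Q" "I + inverse (real (Suc n))"] by (auto simp: I_def)
  then obtain X where X: "\<And>n. Q (X n) < I + inverse (real (Suc n))"
    by metis
  have close: "(dist x y)\<^sup>2 \<le> 2 * (Q x - I) + 2 * (Q y - I)" for x y
  proof -
    have "(dist x y)\<^sup>2 = 2 * Q x + 2 * Q y - 4 * Q ((1/2) *\<^sub>R (x + y))"
      by (simp add: Q_def f.add f.scaleR dist_norm power2_norm_eq_inner inner_add_left
          inner_add_right inner_diff_left inner_diff_right inner_commute algebra_simps)
    with I_le[of "(1/2) *\<^sub>R (x + y)"] show ?thesis by simp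
  qed
  have "Cauchy X"
  proof (rule metric_CauchyI)
    fix e :: real
    assume "0 < e"
    then obtain N where N: "inverse (real (Suc N)) < e\<^sup>2 / 4"
      using reals_Archimedean[of "e\<^sup>2 / 4"] by auto
    have near: "Q (X n) - I < e\<^sup>2 / 4" if "n \<ge> N" for n
    proof -
      have "inverse (real (Suc n)) \<le> inverse (real (Suc N))"
        using that by (simp add: field_simps)
      with X[of n] N show ?thesis by linarith
    qed
    have "dist (X m) (X n) < e" if "m \<ge> N" "n \<ge> N" for m n
    proof (rule power2_less_imp_less)
      show "(dist (X m) (X n))\<^sup>2 < e\<^sup>2"
        using close[of "X m" "X n"] near[OF that(1)] near[OF that(2)] by simp
    qed (use \<open>0 < e\<close> in simp)
    then show "\<exists>M. \<forall>m\<ge>M. \<forall>n\<ge>M. dist (X m) (X n) < e" by blast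
  qed
  then obtain g where g: "X \<longlonglongrightarrow> g"
    by (metis Cauchy_convergent convergentD)
  have "(\<lambda>n. Q (X n)) \<longlonglongrightarrow> Q g"
    unfolding Q_def by (intro tendsto_intros f.tendsto g)
  moreover have "(\<lambda>n. I + inverse (real (Suc n))) \<longlonglongrightarrow> I"
    using tendsto_add[OF tendsto_const LIMSEQ_inverse_real_of_nat] by simp
  ultimately have "Q g \<le> I"
    using X by (intro LIMSEQ_le[of _ "Q g" _ I]) (auto intro: less_imp_le)
  then have "Q g \<le> Q x" for x
    using I_le[of x] by simp
  then have "f h = g \<bullet> h" for h
    unfolding Q_def by (rule quadratic_minimizer_represents[OF f.linear_axioms])
  then show ?thesis by blast
qed

lemma adjoint_bounded_linear:
  fixes A :: "'a::{real_inner, complete_space} \<Rightarrow> 'b::real_inner"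
  assumes "bounded_linear A"
  shows "A x \<bullet> y = x \<bullet> adjoint A y"
proof -
  have "\<exists>g. \<forall>x. A x \<bullet> y = g \<bullet> x" for y
    using bounded_linear_compose[OF bounded_linear_inner_left assms]
    by (rule riesz_representation)
  then obtain B where "\<forall>x y. A x \<bullet> y = x \<bullet> B y"
    by (metis inner_commute)
  then have "\<forall>x y. A x \<bullet> y = x \<bullet> adjoint A y"
    unfolding adjoint_def
    by (rule someI[of "\<lambda>B. \<forall>x y. A x \<bullet> y = x \<bullet> B y"])
  then show ?thesis by blast
qed

lemma self_adjoint_inner:
  assumes "self_adjoint A"
  shows "A x \<bullet> y = x \<bullet> A y"
  using adjoint_bounded_linear[of A x y] assms by (simp add: self_adjoint_def)

section \<open>The gradient of a twice continuously differentiable function\<close>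

lemma bij_blinfun_inner_left:
  "bij (blinfun_inner_left :: 'a::{real_inner, complete_space} \<Rightarrow> 'a \<Rightarrow>\<^sub>L real)"
proof (rule bijI)
  show "inj (blinfun_inner_left :: 'a \<Rightarrow> 'a \<Rightarrow>\<^sub>L real)"
  proof (rule injI)
    fix x y :: 'a
    assume "blinfun_inner_left x = blinfun_inner_left y"
    then have "blinfun_apply (blinfun_inner_left x) h = blinfun_apply (blinfun_inner_left y) h" for h
      by simp
    then have "\<forall>h. h \<bullet> x = h \<bullet> y"
      by simp
    then show "x = y"
      by (simp only: vector_eq_ldot)
  qed
  show "surj (blinfun_inner_left :: 'a \<Rightarrow> 'a \<Rightarrow>\<^sub>L real)"
  unfolding surj_def
  proof
    fix f :: "'a \<Rightarrow>\<^sub>L real"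
    obtain g where "\<forall>h. f h = g \<bullet> h"
      using riesz_representation[OF blinfun.bounded_linear_right] by blast
    then have "f = blinfun_inner_left g"
      by (intro blinfun_eqI) (simp add: inner_commute)
    then show "\<exists>g. f = blinfun_inner_left g" ..
  qed
qed

lemma inner_inv_blinfun_inner_left:
  fixes f :: "'a::{real_inner, complete_space} \<Rightarrow>\<^sub>L real"
  shows "h \<bullet> inv blinfun_inner_left f = blinfun_apply f h"
proof -
  have "blinfun_inner_left (inv blinfun_inner_left f) = f"
    by (rule surj_f_inv_f[OF bij_is_surj[OF bij_blinfun_inner_left]])
  then have "blinfun_apply (blinfun_inner_left (inv blinfun_inner_left f)) h = blinfun_apply f h"
    by simp
  then show ?thesis
    by simp
qed

text \<open>
  Evaluating the functional \<open>\<langle>\<cdot>, g\<rangle>\<close> at \<open>g\<close> itself gives \<open>\<parallel>g\<parallel>\<^sup>2\<close>, so the representing vector is no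
  longer than the norm of the functional.
\<close>

lemma bounded_linear_inv_blinfun_inner_left:
  "bounded_linear (inv (blinfun_inner_left :: 'a::{real_inner, complete_space} \<Rightarrow> 'a \<Rightarrow>\<^sub>L real))"
    (is "bounded_linear (inv ?D)")
proof -
  interpret D: bounded_linear ?D by (rule bounded_linear_blinfun_inner_left)
  have inv_D: "inv ?D (?D g) = g" and D_inv: "?D (inv ?D f) = f" for f and g :: 'a
    by (rule inv_f_f[OF bij_is_inj[OF bij_blinfun_inner_left]])
      (rule surj_f_inv_f[OF bij_is_surj[OF bij_blinfun_inner_left]])
  show ?thesis
  proof (rule bounded_linear_intro[where K = 1])
    show "inv ?D (x + y) = inv ?D x + inv ?D y" for x y
      using inv_D[of "inv ?D x + inv ?D y"] by (simp add: D.add D_inv)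
    show "inv ?D (r *\<^sub>R x) = r *\<^sub>R inv ?D x" for r x
      using inv_D[of "r *\<^sub>R inv ?D x"] by (simp add: D.scaleR D_inv)
    show "norm (inv ?D f) \<le> norm f * 1" for f
    proof -
      define g where "g = inv ?D f"
      have "norm g * norm g = f g"
        using inner_inv_blinfun_inner_left[of g f]
        by (simp add: dot_square_norm power2_eq_square flip: g_def)
      also have "\<dots> \<le> norm f * norm g"
        using norm_blinfun[of f g] by simp
      finally have "norm g \<le> norm f"
        by (cases "g = 0") simp_all
      then show ?thesis by (simp add: g_def)
    qed
  qed
qed

lemma gradient_eq_inv_blinfun_inner_left:
  assumes "(V has_derivative blinfun_apply f) (at q)"
  shows "gradient V q = inv blinfun_inner_left f"
  unfolding gradient_def
proof (rule the_equality)
  show "GDERIV V q :> inv blinfun_inner_left f"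
    unfolding gderiv_def inner_inv_blinfun_inner_left using assms .
next
  fix g
  assume "GDERIV V q :> g"
  then have "blinfun_apply f = (\<lambda>h. h \<bullet> g)"
    using assms by (auto simp: gderiv_def intro: has_derivative_unique)
  then have "f = blinfun_inner_left g"
    by (intro blinfun_eqI) simp
  then show "g = inv blinfun_inner_left f"
    by (simp add: inv_f_f[OF bij_is_inj[OF bij_blinfun_inner_left]])
qed

lemma C1_map_bounded_linear_compose:
  assumes "bounded_linear L" and "C1_map g"
  shows "C1_map (\<lambda>x. L (g x))"
proof -
  obtain g' where g': "\<And>x. (g has_derivative blinfun_apply (g' x)) (at x)"
    and cont: "continuous_on UNIV g'"
    using assms(2) by (auto simp: C1_map_def)
  define B where "B = Blinfun L"
  have B: "blinfun_apply B = L"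
    by (simp add: B_def bounded_linear_Blinfun_apply assms(1))
  have "((\<lambda>x. L (g x)) has_derivative blinfun_apply (B o\<^sub>L g' x)) (at x)" for x
    using bounded_linear.has_derivative[OF assms(1) g'] by (simp add: blinfun_compose.rep_eq B o_def)
  moreover have "continuous_on UNIV (\<lambda>x. B o\<^sub>L g' x)"
    by (intro continuous_intros cont)
  ultimately show ?thesis
    unfolding C1_map_def by (intro exI conjI allI)
qed

lemma C1_map_gradient:
  assumes "C2_map V"
  shows "C1_map (gradient V)"
proof -
  obtain V' where V': "\<And>x. (V has_derivative blinfun_apply (V' x)) (at x)" and "C1_map V'"
    using assms by (auto simp: C2_map_def)
  have "gradient V = (\<lambda>x. inv blinfun_inner_left (V' x))"
    by (rule ext) (rule gradient_eq_inv_blinfun_inner_left[OF V'])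
  then show ?thesis
    using C1_map_bounded_linear_compose[OF bounded_linear_inv_blinfun_inner_left \<open>C1_map V'\<close>] by simp
qed

section \<open>Shears\<close>

lemma C1_map_shear:
  fixes L :: "'b::real_normed_vector \<Rightarrow> 'a::real_normed_vector" and P :: "'a \<Rightarrow> 'c::real_normed_vector"
  assumes "bounded_linear L" and "bounded_linear P" and "C1_map g"
  shows "C1_map (\<lambda>u. u + L (g (P u)))"
proof -
  obtain g' where g': "\<And>x. (g has_derivative blinfun_apply (g' x)) (at x)"
    and cont: "continuous_on UNIV g'"
    using assms(3) by (auto simp: C1_map_def)
  define B C where "B = Blinfun L" and "C = Blinfun P"
  have BC: "blinfun_apply B = L" "blinfun_apply C = P"
    by (simp_all add: B_def C_def bounded_linear_Blinfun_apply assms)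
  have "((\<lambda>u. u + L (g (P u))) has_derivative
      blinfun_apply (id_blinfun + (B o\<^sub>L (g' (P u) o\<^sub>L C)))) (at u)" for u
  proof -
    have "((\<lambda>u. g (P u)) has_derivative (\<lambda>v. g' (P u) (P v))) (at u)"
      using bounded_linear_imp_has_derivative[OF assms(2)] g' by (rule has_derivative_compose)
    from has_derivative_add[OF has_derivative_ident bounded_linear.has_derivative[OF assms(1) this]]
    show ?thesis
      by (rule has_derivative_eq_rhs) (simp add: fun_eq_iff blinfun.add_left BC)
  qed
  moreover have "continuous_on UNIV (\<lambda>u. id_blinfun + (B o\<^sub>L (g' (P u) o\<^sub>L C)))"
    by (intro continuous_intros continuous_on_compose2[OF cont]
        bounded_linear.continuous_on[OF assms(2)]) simp
  ultimately show ?thesis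
    unfolding C1_map_def by (intro exI conjI allI)
qed

text \<open>
  The hypothesis \<open>P (L y) = 0\<close> says that the displacement is invisible to the coordinate \<open>P\<close> on which
  it depends; hence the shear by \<open>- g\<close> is the inverse.
\<close>

lemma C1_diffeomorphism_shear:
  fixes L :: "'b::real_normed_vector \<Rightarrow> 'a::real_normed_vector" and P :: "'a \<Rightarrow> 'c::real_normed_vector"
  assumes L: "bounded_linear L" and P: "bounded_linear P" and PL: "\<And>y. P (L y) = 0"
    and g: "C1_map g"
  shows "C1_diffeomorphism (\<lambda>u. u + L (g (P u)))" (is "C1_diffeomorphism ?S")
proof -
  interpret L: bounded_linear L by fact
  interpret P: bounded_linear P by fact
  define T where "T u = u + L (- g (P u))" for u
  have TS: "T (?S u) = u" and ST: "?S (T u) = u" for u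
    by (simp_all add: T_def P.add P.diff PL L.neg)
  have "bij ?S"
    by (rule o_bij[of T]) (auto simp: TS ST fun_eq_iff)
  moreover have "inv ?S = T"
    by (rule inv_unique_comp) (auto simp: TS ST fun_eq_iff)
  moreover have "C1_map (\<lambda>x. - g x)"
    using C1_map_bounded_linear_compose[OF bounded_linear_minus[OF bounded_linear_ident] g] .
  then have "C1_map T"
    unfolding T_def using C1_map_shear[OF L P] by blast
  ultimately show ?thesis
    using C1_map_shear[OF L P g] by (simp add: C1_diffeomorphism_def)
qed

lemma frechet_derivative_shear:
  fixes L :: "'b::real_normed_vector \<Rightarrow> 'a::real_normed_vector" and P :: "'a \<Rightarrow> 'c::real_normed_vector"
  assumes "bounded_linear L" and "bounded_linear P" and "C1_map g"
  shows "frechet_derivative (\<lambda>u. u + L (g (P u))) (at u)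
    = (\<lambda>v. v + L (frechet_derivative g (at (P u)) (P v)))"
proof -
  have "g differentiable (at (P u))"
    using assms(3) by (auto simp: C1_map_def differentiable_def)
  then have "(g has_derivative frechet_derivative g (at (P u))) (at (P u))"
    by (simp add: frechet_derivative_works)
  with bounded_linear_imp_has_derivative[OF assms(2)]
  have "((\<lambda>u. g (P u)) has_derivative (\<lambda>v. frechet_derivative g (at (P u)) (P v))) (at u)"
    by (rule has_derivative_compose)
  from has_derivative_add[OF has_derivative_ident bounded_linear.has_derivative[OF assms(1) this]]
  show ?thesis
    by (rule frechet_derivative_at[symmetric])
qed

lemma symplectic_form_Pair: "symplectic_form (a, b) (c, d) = a \<bullet> d - b \<bullet> c"
  by (simp add: symplectic_form_def phase_J_def)

lemma symplectomorphism_momentum_shear: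
  assumes "C2_map V" and sa: "\<And>q. self_adjoint (frechet_derivative (gradient V) (at q))"
  shows "symplectomorphism (momentum_shear V)"
proof -
  have L: "bounded_linear (\<lambda>y. (0 :: 'a, y :: 'a))"
    by (intro bounded_linear_Pair bounded_linear_zero bounded_linear_ident)
  note g = C1_map_gradient[OF assms(1)]
  have eq: "momentum_shear V = (\<lambda>u. u + (0, gradient V (fst u)))"
    by (auto simp: momentum_shear_def)
  have "C1_diffeomorphism (momentum_shear V)"
    unfolding eq by (rule C1_diffeomorphism_shear[OF L bounded_linear_fst _ g]) simp
  moreover have "symplectic_form (frechet_derivative (momentum_shear V) (at u) v)
      (frechet_derivative (momentum_shear V) (at u) w) = symplectic_form v w" for u v w
    unfolding eq frechet_derivative_shear[OF L bounded_linear_fst g]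
    by (cases v; cases w) (simp add: symplectic_form_Pair inner_add_left inner_add_right
        self_adjoint_inner[OF sa])
  ultimately show ?thesis
    by (simp add: symplectomorphism_def)
qed

lemma symplectomorphism_position_shear:
  assumes "C2_map W" and sa: "\<And>p. self_adjoint (frechet_derivative (gradient W) (at p))"
  shows "symplectomorphism (position_shear W)"
proof -
  have L: "bounded_linear (\<lambda>x. (x :: 'a, 0 :: 'a))"
    by (intro bounded_linear_Pair bounded_linear_zero bounded_linear_ident)
  note g = C1_map_gradient[OF assms(1)]
  have eq: "position_shear W = (\<lambda>u. u + (gradient W (snd u), 0))"
    by (auto simp: position_shear_def)
  have "C1_diffeomorphism (position_shear W)"
    unfolding eq by (rule C1_diffeomorphism_shear[OF L bounded_linear_snd _ g]) simp
  moreover have "symplectic_form (frechet_derivative (position_shear W) (at u) v)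
      (frechet_derivative (position_shear W) (at u) w) = symplectic_form v w" for u v w
    unfolding eq frechet_derivative_shear[OF L bounded_linear_snd g]
    by (cases v; cases w) (simp add: symplectic_form_Pair inner_add_left inner_add_right
        self_adjoint_inner[OF sa])
  ultimately show ?thesis
    by (simp add: symplectomorphism_def)
qed

theorem proposition4p5:
  fixes V W :: "'a::{real_inner, complete_space} \<Rightarrow> real"
  shows "(C2_map V \<and> (\<forall>q. self_adjoint (frechet_derivative (gradient V) (at q)))
            \<longrightarrow> symplectomorphism (momentum_shear V))
       \<and> (C2_map W \<and> (\<forall>p. self_adjoint (frechet_derivative (gradient W) (at p)))
            \<longrightarrow> symplectomorphism (position_shear W))"
  by (simp add: symplectomorphism_momentum_shear symplectomorphism_position_shear)

end
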